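(* Let $\tau\ge1$, $\sigma=(\sigma_1,\dots,\sigma_\tau)\in\mathbb{Z}_{\ge1}^\tau$, and define $S:=\prod_{i=1}^\tau(\sigma_i+1)$. (i) Let $\mathcal{A}\in\mathbb{Z}^{S\times(S-1)}$ be bi-diagonal. Then, up to a permutation of its columns, $\mathcal{A}$ is a multi-stage matrix with $\tau$ stages and stage sizes $\sigma$. (ii) Let $\mathcal{A}\in\mathbb{Z}^{2S\times(2S-2)}$ be tri-diagonal. Then, up to a permutation of its columns, $\mathcal{A}$ is a multi-stage matrix with $\tau$ stages and stage sizes $2\sigma=(2\sigma_1,\dots,2\sigma_\tau)$.
   Context: A matrix $\mathcal{A}=(a_{i,j})\in\mathbb{Z}^{m\times n}$ is bi-diagonal if $a_{i,j}=0$ whenever $i\notin\{j,j+1\}$, and tri-diagonal if $a_{i,j}=0$ whenever $i\notin\{j,j+1,j+2\}$. Tree-fold matrices (recursive definition): any matrix $A\in\mathbb{Z}^{m\times n}$ is a tree-fold matrix with one level and level size $m$. A matrix $A$ is a tree-fold matrix with $\tau\ge 2$ levels and level sizes $\sigma=(\sigma_1,\dots,\sigma_\tau)\in\mathbb{Z}_{\ge1}^\tau$ if deleting the first $\sigma_1$ rows of $A$ decomposes the matrix into a block-diagonal matrix, where each (not necessarily square) block is a tree-fold matrix with $\tau-1$ levels and level sizes $(\sigma_2,\dots,\sigma_\tau)$. Multi-stage matrices: $A$ is a multi-stage matrix with $\tau$ stages and stage sizes $\sigma$ if $A^\intercal$ is a tree-fold matrix with $\tau$ levels and level sizes $\sigma$.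 *)

theory Defs
  imports
    "Jordan_Normal_Form.Matrix"
    "HOL-Combinatorics.Permutations"
begin

text \<open>Matrix indices start at 0. The two band conditions below are invariant under this shift of
  the row and column indices.\<close>

definition bi_diagonal :: "'a :: zero mat \<Rightarrow> bool" where
  "bi_diagonal A \<longleftrightarrow>
     (\<forall>i < dim_row A. \<forall>j < dim_col A. i \<notin> {j, j + 1} \<longrightarrow> A $$ (i, j) = 0)"

definition tri_diagonal :: "'a :: zero mat \<Rightarrow> bool" where
  "tri_diagonal A \<longleftrightarrow>
     (\<forall>i < dim_row A. \<forall>j < dim_col A. i \<notin> {j, j + 1, j + 2} \<longrightarrow> A $$ (i, j) = 0)"

definition delete_first_rows :: "nat \<Rightarrow> 'a mat \<Rightarrow> 'a mat" where
  "delete_first_rows s A = mat_of_rows (dim_col A) (drop s (rows A))"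

text \<open>The number of levels is the length of the list of level sizes. An \<open>m \<times> n\<close> matrix is understood
  to have \<open>m, n \<ge> 1\<close>, and level sizes are at least 1. In particular the blocks are nonempty
  (a block without columns would amount to a group of zero rows), and there is at least one of them.\<close>

inductive tree_fold :: "nat list \<Rightarrow> 'a :: zero mat \<Rightarrow> bool" where
  one_level: "A \<in> carrier_mat m n \<Longrightarrow> 1 \<le> m \<Longrightarrow> 1 \<le> n \<Longrightarrow> tree_fold [m] A"
| more_levels: "1 \<le> s \<Longrightarrow> Bs \<noteq> [] \<Longrightarrow> delete_first_rows s A = diag_block_mat Bs \<Longrightarrow>
    (\<forall>B \<in> set Bs. tree_fold \<sigma> B) \<Longrightarrow> tree_fold (s # \<sigma>) A"

definition multi_stage :: "nat list \<Rightarrow> 'a :: zero mat \<Rightarrow> bool" where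
  "multi_stage \<sigma> A \<longleftrightarrow> tree_fold \<sigma> (transpose_mat A)"

definition permute_cols :: "(nat \<Rightarrow> nat) \<Rightarrow> 'a mat \<Rightarrow> 'a mat" where
  "permute_cols \<pi> A = mat (dim_row A) (dim_col A) (\<lambda>(i, j). A $$ (i, \<pi> j))"

end

theory Submission
  imports Defs
begin

text \<open>We transpose and let \<open>T\<close> be a matrix with entries only in the positions \<open>(i, j)\<close> with
  \<open>i \<le> j \<le> i + d\<close>; the two claims are \<open>d = 1\<close> and \<open>d = 2\<close>. Write \<open>S = (s + 1) S'\<close> and \<open>M = d S'\<close>.
  Cut the \<open>(s + 1) M\<close> columns of \<open>T\<close> into \<open>s + 1\<close> intervals of length \<open>M\<close>. The only rows that meet
  two intervals are the last \<open>d\<close> rows before each of the \<open>s\<close> cuts. Moving these \<open>d s\<close> rows to the top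
  leaves a block-diagonal matrix whose \<open>s + 1\<close> blocks are banded of size \<open>(M - d) \<times> M\<close>, so that
  induction on the number of levels applies. A row permutation is handled as an equality of the
  multisets of rows.\<close>

definition upper_band :: "nat \<Rightarrow> 'a :: zero mat \<Rightarrow> bool" where
  "upper_band d T \<longleftrightarrow> (\<forall>i < dim_row T. \<forall>j < dim_col T. j \<notin> {i..i + d} \<longrightarrow> T $$ (i, j) = 0)"

lemma rows_four_block_diag:
  assumes "A \<in> carrier_mat m n" "B \<in> carrier_mat k l"
  shows "rows (four_block_mat A (0\<^sub>m m l) (0\<^sub>m k n) B) =
    map (\<lambda>v. v @\<^sub>v 0\<^sub>v l) (rows A) @ map (\<lambda>v. 0\<^sub>v n @\<^sub>v v) (rows B)"
  using assms by (intro nth_equalityI) (auto simp: nth_append intro!: eq_vecI)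

text \<open>A row \<open>i < M - d\<close> has its band inside columns up to
  \<open>i + d < M\<close>, and a row \<open>i \<ge> M\<close> has no entry left of column
  \<open>M\<close>. Only the \<open>d\<close> rows in between can straddle the cut, so they are kept
  whole.\<close>

lemma rows_band_split:
  assumes T: "T \<in> carrier_mat (M + k) (M + l)" and band: "upper_band d T" and "d \<le> M"
  shows "rows T =
    map (\<lambda>v. v @\<^sub>v 0\<^sub>v l) (rows (mat (M - d) M (\<lambda>(i, j). T $$ (i, j)))) @
    map (row T) [M - d..<M] @
    map (\<lambda>v. 0\<^sub>v M @\<^sub>v v) (rows (mat k l (\<lambda>(i, j). T $$ (M + i, M + j))))"
proof (rule nth_equalityI)
  fix i assume "i < length (rows T)"
  then have i: "i < M + k" using T by simp
  have zero: "T $$ (i, j) = 0" if "j < M + l" "j < i \<or> i + d < j" for j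
    using band i that T unfolding upper_band_def by auto
  consider "i < M - d" | "M - d \<le> i" "i < M" | "M \<le> i" by linarith
  then show "rows T ! i = (map (\<lambda>v. v @\<^sub>v 0\<^sub>v l) (rows (mat (M - d) M (\<lambda>(i, j). T $$ (i, j)))) @
    map (row T) [M - d..<M] @
    map (\<lambda>v. 0\<^sub>v M @\<^sub>v v) (rows (mat k l (\<lambda>(i, j). T $$ (M + i, M + j))))) ! i"
    using i T \<open>d \<le> M\<close>
    by cases (auto simp: nth_append intro!: eq_vecI zero)
qed (use T \<open>d \<le> M\<close> in auto)

text \<open>Induction on the number \<open>s\<close> of cuts, peeling off the first interval of
  columns each time. The hypothesis on single blocks stands for the induction on levels;
  \<open>D\<close> collects the straddling rows, \<open>d\<close> for each cut.\<close>

lemma band_block_decomposition: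
  fixes T :: "'a :: zero mat"
  assumes IH: "\<And>B :: 'a mat. B \<in> carrier_mat (M - d) M \<Longrightarrow> upper_band d B \<Longrightarrow>
      \<exists>B' \<in> carrier_mat (M - d) M. mset (rows B') = mset (rows B) \<and> tree_fold \<sigma> B'"
    and "d \<le> M"
    and "T \<in> carrier_mat (Suc s * M - d) (Suc s * M)" "upper_band d T"
  shows "\<exists>D Bs. length D = d * s \<and> set D \<subseteq> carrier_vec (Suc s * M) \<and>
    Bs \<noteq> [] \<and> (\<forall>B \<in> set Bs. tree_fold \<sigma> B) \<and>
    diag_block_mat Bs \<in> carrier_mat (Suc s * (M - d)) (Suc s * M) \<and>
    mset (rows T) = mset D + mset (rows (diag_block_mat Bs))"
  using assms(3,4)
proof (induction s arbitrary: T)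
  case 0
  then obtain B where B: "B \<in> carrier_mat (M - d) M" "mset (rows B) = mset (rows T)" "tree_fold \<sigma> B"
    using IH[of T] by auto
  have "diag_block_mat [B] = B" by (rule diag_block_mat_singleton)
  with B show ?case by (intro exI[of _ "[]"] exI[of _ "[B]"]) auto
next
  case (Suc s)
  \<comment> \<open>These are the dimensions left after the first interval, so that \<open>R\<close>
    has the shape required by the induction hypothesis for \<open>s\<close>.\<close>
  define k l where "k = Suc s * M - d" and "l = Suc s * M"
  have T: "T \<in> carrier_mat (M + k) (M + l)"
    using Suc.prems(1) \<open>d \<le> M\<close> by (simp add: k_def l_def)
  define U where "U = mat (M - d) M (\<lambda>(i, j). T $$ (i, j))"
  define R where "R = mat k l (\<lambda>(i, j). T $$ (M + i, M + j))"
  have "upper_band d U" "upper_band d R"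
    using Suc.prems(2) T \<open>d \<le> M\<close> unfolding upper_band_def U_def R_def by auto
  then obtain B where B: "B \<in> carrier_mat (M - d) M" "mset (rows B) = mset (rows U)" "tree_fold \<sigma> B"
    using IH[of U] by (auto simp: U_def)
  obtain D Bs where D: "length D = d * s" "set D \<subseteq> carrier_vec l"
    and Bs: "\<forall>B \<in> set Bs. tree_fold \<sigma> B"
      "diag_block_mat Bs \<in> carrier_mat (Suc s * (M - d)) l"
      "mset (rows R) = mset D + mset (rows (diag_block_mat Bs))"
    using Suc.IH[of R] \<open>upper_band d R\<close> by (auto simp: R_def k_def l_def)
  have diag: "diag_block_mat (B # Bs) =
      four_block_mat B (0\<^sub>m (M - d) l) (0\<^sub>m (Suc s * (M - d)) M) (diag_block_mat Bs)"
    using B(1) Bs(2) by (auto simp: Let_def)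
  \<comment> \<open>The rows straddling the first cut, followed by those of the later cuts, which
    are padded with zeros in the first \<open>M\<close> columns.\<close>
  let ?D = "map (row T) [M - d..<M] @ map (\<lambda>v. 0\<^sub>v M @\<^sub>v v) D"
  have "mset (rows T) = mset ?D + mset (rows (diag_block_mat (B # Bs)))"
    unfolding rows_band_split[OF T Suc.prems(2) \<open>d \<le> M\<close>] diag
      rows_four_block_diag[OF B(1) Bs(2)] U_def[symmetric] R_def[symmetric]
    by (simp add: B(2) Bs(3))
  moreover have "length ?D = d * Suc s" using D \<open>d \<le> M\<close> by simp
  moreover have "set ?D \<subseteq> carrier_vec (M + l)" using D T by (auto intro: carrier_vecI)
  moreover have "diag_block_mat (B # Bs) \<in> carrier_mat (M - d + Suc s * (M - d)) (M + l)"
    unfolding diag using B(1) Bs(2) by (rule four_block_carrier_mat)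
  ultimately show ?case using B(3) Bs(1)
    by (intro exI[of _ ?D] exI[of _ "B # Bs"]) (auto simp: l_def)
qed

lemma tree_fold_upper_band:
  fixes T :: "'a :: zero mat"
  assumes "\<sigma> \<noteq> []" "\<forall>s \<in> set \<sigma>. 1 \<le> s" "1 \<le> d" "S = prod_list (map Suc \<sigma>)"
    and "T \<in> carrier_mat (d * S - d) (d * S)" "upper_band d T"
  shows "\<exists>T' \<in> carrier_mat (d * S - d) (d * S).
    mset (rows T') = mset (rows T) \<and> tree_fold (map (\<lambda>s. d * s) \<sigma>) T'"
  using assms
proof (induction \<sigma> arbitrary: S T rule: list_nonempty_induct)
  case (single s)
  \<comment> \<open>Here \<open>S = s + 1\<close>, so \<open>d * S - d\<close> is exactly the level
    size \<open>d * s\<close>.\<close>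
  then have "tree_fold [d * s] T"
    by (intro one_level[of _ _ "d * S"]) auto
  with single show ?case by auto
next
  case (cons s \<sigma>)
  define S' where "S' = prod_list (map Suc \<sigma>)"
  define M where "M = d * S'"
  \<comment> \<open>This yields \<open>d \<le> M\<close>, so the natural-number subtraction in the
    block height \<open>M - d\<close> is not truncated.\<close>
  have "1 \<le> S'" unfolding S'_def by (induction \<sigma>) auto
  then have "d \<le> M" by (simp add: M_def)
  have S: "d * S = Suc s * M"
    using cons.prems by (simp add: S'_def M_def algebra_simps)
  have IH: "\<exists>B' \<in> carrier_mat (M - d) M. mset (rows B') = mset (rows B) \<and>
      tree_fold (map (\<lambda>s. d * s) \<sigma>) B'"
    if "B \<in> carrier_mat (M - d) M" "upper_band d B" for B :: "'a mat"
    using cons.IH[OF _ _ S'_def, of B] cons.prems that by (auto simp: M_def)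
  obtain D Bs where D: "length D = d * s" "set D \<subseteq> carrier_vec (d * S)"
    and Bs: "Bs \<noteq> []" "\<forall>B \<in> set Bs. tree_fold (map (\<lambda>s. d * s) \<sigma>) B"
      "diag_block_mat Bs \<in> carrier_mat (Suc s * (M - d)) (d * S)"
      "mset (rows T) = mset D + mset (rows (diag_block_mat Bs))"
    using band_block_decomposition[OF IH \<open>d \<le> M\<close>, of T s] cons.prems unfolding S by metis
  let ?E = "D @ rows (diag_block_mat Bs)"
  \<comment> \<open>Since \<open>D\<close> has length \<open>d * s\<close>, deleting that many rows
    from the top leaves precisely the block-diagonal part.\<close>
  define T' where "T' = mat_of_rows (d * S) ?E"
  have "set ?E \<subseteq> carrier_vec (d * S)"
    using D(2) Bs(3) rows_carrier[of "diag_block_mat Bs"] by auto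
  then have rows: "rows T' = ?E"
    unfolding T'_def by (rule rows_mat_of_rows)
  have msetT: "mset (rows T') = mset (rows T)"
    by (simp add: rows Bs(4))
  then have "dim_row T' = dim_row T"
    by (metis length_rows size_mset)
  then have carrier: "T' \<in> carrier_mat (d * S - d) (d * S)"
    using cons.prems(4) by (intro carrier_matI) (simp_all add: T'_def)
  have "delete_first_rows (d * s) T' = diag_block_mat Bs"
    using Bs(3) mat_of_rows_rows[of "diag_block_mat Bs"]
    unfolding delete_first_rows_def rows by (simp add: D(1) T'_def)
  then have "tree_fold (map (\<lambda>s. d * s) (s # \<sigma>)) T'"
    using cons.prems(1,2) Bs(1,2) unfolding list.map
    by (intro more_levels[where Bs = Bs]) auto
  with msetT carrier show ?case by blast
qed

text \<open>Equal multisets of rows of \<open>T\<close> and columns of \<open>A\<close> give a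
  permutation \<open>\<pi>\<close> matching row \<open>i\<close> of \<open>T\<close> with column
  \<open>\<pi> i\<close> of \<open>A\<close>; permuting the columns by \<open>\<pi>\<close> and
  transposing then gives \<open>T\<close> itself.\<close>

lemma multi_stage_permute_cols:
  fixes A :: "'a :: zero mat"
  assumes "T \<in> carrier_mat n m" "A \<in> carrier_mat m n"
    and "mset (rows T) = mset (cols A)" "tree_fold \<sigma> T"
  shows "\<exists>\<pi>. \<pi> permutes {..<n} \<and> multi_stage \<sigma> (permute_cols \<pi> A)"
proof -
  obtain \<pi> where \<pi>: "\<pi> permutes {..<n}" "permute_list \<pi> (cols A) = rows T"
    using mset_eq_permutation[OF assms(3)] assms(2) by auto
  have "(permute_cols \<pi> A)\<^sup>T = T"
  proof (rule eq_rowI)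
    fix i assume "i < dim_row T"
    then have i: "i < n" using assms(1) by simp
    then have "\<pi> i < n" using permutes_in_image[OF \<pi>(1), of i] by simp
    have "row T i = permute_list \<pi> (cols A) ! i"
      using i assms(1) by (simp add: \<pi>(2))
    also have "\<dots> = col A (\<pi> i)"
      using i \<open>\<pi> i < n\<close> \<pi>(1) assms(2) by (simp add: permute_list_nth)
    finally show "row (permute_cols \<pi> A)\<^sup>T i = row T i"
      using i \<open>\<pi> i < n\<close> assms(2) by (auto simp: permute_cols_def intro!: eq_vecI)
  qed (use assms in \<open>auto simp: permute_cols_def\<close>)
  with \<pi>(1) assms(4) show ?thesis unfolding multi_stage_def by auto
qed

lemma multi_stage_band:
  fixes A :: "'a :: zero mat"
  assumes "\<sigma> \<noteq> []" "\<forall>s \<in> set \<sigma>. 1 \<le> s" "1 \<le> d" "S = prod_list (map Suc \<sigma>)"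
    and "A \<in> carrier_mat (d * S) (d * S - d)" "upper_band d A\<^sup>T"
  shows "\<exists>\<pi>. \<pi> permutes {..<d * S - d} \<and>
    multi_stage (map (\<lambda>s. d * s) \<sigma>) (permute_cols \<pi> A)"
proof -
  have "A\<^sup>T \<in> carrier_mat (d * S - d) (d * S)" using assms(5) by simp
  from tree_fold_upper_band[OF assms(1-4) this assms(6)] show ?thesis
    using multi_stage_permute_cols[OF _ assms(5)] by auto
qed

theorem lemma1:
  fixes \<tau> S :: nat and \<sigma> :: "nat list"
  assumes "1 \<le> \<tau>" and "length \<sigma> = \<tau>" and "\<forall>i < \<tau>. 1 \<le> \<sigma> ! i"
    and "S = (\<Prod>i < \<tau>. (\<sigma> ! i + 1))"
  shows "(\<forall>A :: int mat. A \<in> carrier_mat S (S - 1) \<longrightarrow> bi_diagonal A \<longrightarrow>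
            (\<exists>\<pi>. \<pi> permutes {..<S - 1} \<and> multi_stage \<sigma> (permute_cols \<pi> A))) \<and>
         (\<forall>A :: int mat. A \<in> carrier_mat (2 * S) (2 * S - 2) \<longrightarrow> tri_diagonal A \<longrightarrow>
            (\<exists>\<pi>. \<pi> permutes {..<2 * S - 2} \<and>
                 multi_stage (map (\<lambda>s. 2 * s) \<sigma>) (permute_cols \<pi> A)))"
proof -
  have ne: "\<sigma> \<noteq> []" and pos: "\<forall>s \<in> set \<sigma>. 1 \<le> s"
    using assms(1-3) by (auto simp: in_set_conv_nth)
  have S: "S = prod_list (map Suc \<sigma>)"
    using assms(2,4) by (simp add: prod.list_conv_set_nth atLeast0LessThan)
  note multi_stage = multi_stage_band[where 'a = int, OF ne pos _ S]
  have "upper_band 1 A\<^sup>T" if "bi_diagonal A" for A :: "int mat"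
    using that unfolding upper_band_def bi_diagonal_def by auto
  moreover have "upper_band 2 A\<^sup>T" if "tri_diagonal A" for A :: "int mat"
    using that unfolding upper_band_def tri_diagonal_def by auto
  ultimately show ?thesis
    using multi_stage[of 1] multi_stage[of 2] by auto
qed

end
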